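(* Let $E$ be a real or complex Banach space and let $A\in\mathcal L(E)$ be invertible. Then the map $f$ given by $f(B):=B^{-1}$, defined on the open set of invertible operators in $\mathcal L(E)$ with values in $\mathcal L(E)$, is differentiable at $A$, and for all $Z\in\mathcal L(E)$, $$Df(A)Z=-A^{-1}ZA^{-1}.$$
   Context: $\mathcal L(X,Y)$ denotes the space of bounded linear operators between Banach spaces $X$ and $Y$ with the operator norm, and $\mathcal L(X):=\mathcal L(X,X)$. An operator $B\in\mathcal L(E)$ is invertible if it has an inverse in $\mathcal L(E)$; the set of invertible operators is open in $\mathcal L(E)$. Differentiability (in the sense of Carathéodory): for Banach spaces $X,Y$ and $W\subseteq X$ open, $f\colon W\to Y$ is differentiable at $x\in W$ if there exists a map $\Phi_x\colon W\to\mathcal L(X,Y)$, continuous at $x$, such that $f(y)=f(x)+\Phi_x(y)(y-x)$ for all $y\in W$; then $Df(x):=\Phi_x(x)$ is the derivative of $f$ at $x$ (it does not depend on the choice of $\Phi_x$). *)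

theory Defs
  imports "HOL-Analysis.Analysis"
begin

text \<open>
  HOL-Analysis only has real normed spaces. A complex normed space is presented here as its
  underlying real normed space together with a complex scalar multiplication that extends
  the real one and for which the norm is homogeneous.
\<close>

class complex_normed_vector = real_normed_vector +
  fixes scaleC :: "complex \<Rightarrow> 'a \<Rightarrow> 'a"  (infixr \<open>*\<^sub>C\<close> 75)
  assumes scaleC_add_right: "c *\<^sub>C (x + y) = c *\<^sub>C x + c *\<^sub>C y"
    and scaleC_add_left: "(c + d) *\<^sub>C x = c *\<^sub>C x + d *\<^sub>C x"
    and scaleC_scaleC: "c *\<^sub>C d *\<^sub>C x = (c * d) *\<^sub>C x"
    and scaleC_of_real: "complex_of_real r *\<^sub>C x = r *\<^sub>R x"
    and norm_scaleC: "norm (c *\<^sub>C x) = cmod c * norm x"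

class complex_banach = complex_normed_vector + complete_space

subclass (in complex_banach) banach ..

lemma scaleC_one: "1 *\<^sub>C x = (x :: 'a::complex_normed_vector)"
  using scaleC_of_real[of 1 x] by simp

lemma scaleC_minus_right: "c *\<^sub>C (- x) = - (c *\<^sub>C (x :: 'a::complex_normed_vector))"
proof -
  have "c *\<^sub>C (0 :: 'a) = 0"
    using scaleC_add_right[of c "0 :: 'a" 0] by simp
  then have "c *\<^sub>C x + c *\<^sub>C (- x) = 0"
    using scaleC_add_right[of c x "- x"] by simp
  then show ?thesis
    by (simp add: eq_neg_iff_add_eq_0 add.commute)
qed

lemma bounded_linear_scaleC: "bounded_linear (\<lambda>x :: 'a::complex_normed_vector. c *\<^sub>C x)"
proof (rule bounded_linear_intro[where K = "cmod c"])
  fix x y :: 'a and r :: real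
  show "c *\<^sub>C (x + y) = c *\<^sub>C x + c *\<^sub>C y"
    by (rule scaleC_add_right)
  show "c *\<^sub>C (r *\<^sub>R x) = r *\<^sub>R (c *\<^sub>C x)"
    by (simp add: scaleC_of_real[symmetric] scaleC_scaleC mult.commute)
  show "norm (c *\<^sub>C x) \<le> norm x * cmod c"
    by (simp add: norm_scaleC mult.commute)
qed

lemma scaleC_diff_right: "c *\<^sub>C (x - y) = c *\<^sub>C x - c *\<^sub>C (y :: 'a::complex_normed_vector)"
  using scaleC_add_right[of c x "- y"] by (simp add: scaleC_minus_right)

instantiation complex :: complex_banach
begin

definition scaleC_complex :: "complex \<Rightarrow> complex \<Rightarrow> complex"
  where "scaleC_complex c x = c * x"

instance
  by standard (simp_all add: scaleC_complex_def algebra_simps norm_mult scaleR_conv_of_real)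

end

text \<open>
  Complex-linear operators form a subtype of the bounded real-linear ones, from
  which they inherit the operator norm.
\<close>

typedef (overloaded) ('a, 'b) cblinfun (\<open>(_ \<Rightarrow>\<^sub>C\<^sub>L /_)\<close> [22, 21] 21) =
  "{T :: 'a::complex_normed_vector \<Rightarrow>\<^sub>L 'b::complex_normed_vector.
      \<forall>c x. blinfun_apply T (c *\<^sub>C x) = c *\<^sub>C blinfun_apply T x}"
  morphisms blinfun_of_cblinfun cblinfun_of_blinfun
proof -
  have "c *\<^sub>C 0 = (0 :: 'b)" for c
    using scaleC_add_right[of c "0 :: 'b" 0] by simp
  then have "(0 :: 'a \<Rightarrow>\<^sub>L 'b) \<in> {T. \<forall>c x. blinfun_apply T (c *\<^sub>C x) = c *\<^sub>C blinfun_apply T x}"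
    by simp
  then show ?thesis ..
qed

setup_lifting type_definition_cblinfun

lift_definition cblinfun_apply ::
  "('a::complex_normed_vector \<Rightarrow>\<^sub>C\<^sub>L 'b::complex_normed_vector) \<Rightarrow> 'a \<Rightarrow> 'b"
  is blinfun_apply .

lemma cblinfun_eqI:
  fixes S T :: "'a::complex_normed_vector \<Rightarrow>\<^sub>C\<^sub>L 'b::complex_normed_vector"
  shows "(\<And>x. cblinfun_apply S x = cblinfun_apply T x) \<Longrightarrow> S = T"
  by transfer (rule blinfun_eqI)

lemma cblinfun_apply_scaleC:
  fixes T :: "'a::complex_normed_vector \<Rightarrow>\<^sub>C\<^sub>L 'b::complex_normed_vector"
  shows "cblinfun_apply T (c *\<^sub>C x) = c *\<^sub>C cblinfun_apply T x"
  by transfer simp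

lift_definition id_cblinfun :: "'a::complex_normed_vector \<Rightarrow>\<^sub>C\<^sub>L 'a"
  is id_blinfun by simp

lift_definition cblinfun_compose ::
  "('b::complex_normed_vector \<Rightarrow>\<^sub>C\<^sub>L 'c::complex_normed_vector) \<Rightarrow>
   ('a::complex_normed_vector \<Rightarrow>\<^sub>C\<^sub>L 'b) \<Rightarrow> ('a \<Rightarrow>\<^sub>C\<^sub>L 'c)"  (infixl \<open>o\<^sub>C\<^sub>L\<close> 55)
  is blinfun_compose by simp

lemma Blinfun_scaleC_apply:
  fixes T :: "'a::real_normed_vector \<Rightarrow>\<^sub>L 'b::complex_normed_vector"
  shows "blinfun_apply (Blinfun (\<lambda>x. c *\<^sub>C blinfun_apply T x)) = (\<lambda>x. c *\<^sub>C blinfun_apply T x)"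
  by (intro bounded_linear_Blinfun_apply bounded_linear_compose[OF bounded_linear_scaleC]
      blinfun.bounded_linear_right)

instantiation cblinfun :: (complex_normed_vector, complex_normed_vector) complex_normed_vector
begin

lift_definition norm_cblinfun :: "('a \<Rightarrow>\<^sub>C\<^sub>L 'b) \<Rightarrow> real" is norm .

lift_definition zero_cblinfun :: "'a \<Rightarrow>\<^sub>C\<^sub>L 'b" is 0
  using scaleC_add_right[of _ "0 :: 'b" 0] by simp

lift_definition plus_cblinfun :: "('a \<Rightarrow>\<^sub>C\<^sub>L 'b) \<Rightarrow> ('a \<Rightarrow>\<^sub>C\<^sub>L 'b) \<Rightarrow> ('a \<Rightarrow>\<^sub>C\<^sub>L 'b)" is "(+)"
  by (simp add: blinfun.add_left scaleC_add_right)

lift_definition uminus_cblinfun :: "('a \<Rightarrow>\<^sub>C\<^sub>L 'b) \<Rightarrow> ('a \<Rightarrow>\<^sub>C\<^sub>L 'b)" is uminus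
  by (simp add: blinfun.minus_left scaleC_minus_right)

lift_definition minus_cblinfun :: "('a \<Rightarrow>\<^sub>C\<^sub>L 'b) \<Rightarrow> ('a \<Rightarrow>\<^sub>C\<^sub>L 'b) \<Rightarrow> ('a \<Rightarrow>\<^sub>C\<^sub>L 'b)" is "(-)"
  by (simp add: blinfun.diff_left scaleC_diff_right)

lift_definition scaleR_cblinfun :: "real \<Rightarrow> ('a \<Rightarrow>\<^sub>C\<^sub>L 'b) \<Rightarrow> ('a \<Rightarrow>\<^sub>C\<^sub>L 'b)" is scaleR
  by (simp add: blinfun.scaleR_left scaleC_of_real[symmetric] scaleC_scaleC mult.commute)

lift_definition scaleC_cblinfun :: "complex \<Rightarrow> ('a \<Rightarrow>\<^sub>C\<^sub>L 'b) \<Rightarrow> ('a \<Rightarrow>\<^sub>C\<^sub>L 'b)"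
  is "\<lambda>c T. Blinfun (\<lambda>x. c *\<^sub>C blinfun_apply T x)"
  by (simp add: Blinfun_scaleC_apply scaleC_scaleC mult.commute)

definition dist_cblinfun :: "('a \<Rightarrow>\<^sub>C\<^sub>L 'b) \<Rightarrow> ('a \<Rightarrow>\<^sub>C\<^sub>L 'b) \<Rightarrow> real"
  where "dist_cblinfun S T = norm (S - T)"

definition [code del]:
  "(uniformity :: (('a \<Rightarrow>\<^sub>C\<^sub>L 'b) \<times> ('a \<Rightarrow>\<^sub>C\<^sub>L 'b)) filter)
     = (INF e\<in>{0 <..}. principal {(x, y). dist x y < e})"

definition open_cblinfun :: "('a \<Rightarrow>\<^sub>C\<^sub>L 'b) set \<Rightarrow> bool"
  where [code del]:
    "open_cblinfun S = (\<forall>x\<in>S. \<forall>\<^sub>F (x', y) in uniformity. x' = x \<longrightarrow> y \<in> S)"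

definition sgn_cblinfun :: "('a \<Rightarrow>\<^sub>C\<^sub>L 'b) \<Rightarrow> ('a \<Rightarrow>\<^sub>C\<^sub>L 'b)"
  where "sgn_cblinfun T = scaleR (inverse (norm T)) T"

lemma cblinfun_apply_plus:
  "cblinfun_apply (S + T :: 'a \<Rightarrow>\<^sub>C\<^sub>L 'b) x = cblinfun_apply S x + cblinfun_apply T x"
  by transfer (rule blinfun.add_left)

lemma cblinfun_apply_scaleR:
  "cblinfun_apply (r *\<^sub>R T :: 'a \<Rightarrow>\<^sub>C\<^sub>L 'b) x = r *\<^sub>R cblinfun_apply T x"
  by transfer (rule blinfun.scaleR_left)

lemma cblinfun_apply_scaleC_left:
  "cblinfun_apply (c *\<^sub>C T :: 'a \<Rightarrow>\<^sub>C\<^sub>L 'b) x = c *\<^sub>C cblinfun_apply T x"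
  by transfer (simp add: Blinfun_scaleC_apply)

instance
proof
  fix c d :: complex and r s :: real and R S T :: "'a \<Rightarrow>\<^sub>C\<^sub>L 'b" and U :: "('a \<Rightarrow>\<^sub>C\<^sub>L 'b) set"
  show "R + S + T = R + (S + T)" "S + T = T + S" "0 + T = T" "- T + T = 0" "S - T = S + - T"
    "r *\<^sub>R (S + T) = r *\<^sub>R S + r *\<^sub>R T" "(r + s) *\<^sub>R T = r *\<^sub>R T + s *\<^sub>R T"
    "r *\<^sub>R s *\<^sub>R T = (r * s) *\<^sub>R T" "1 *\<^sub>R T = T"
    "norm (S + T) \<le> norm S + norm T" "norm (r *\<^sub>R T) = \<bar>r\<bar> * norm T" "norm T = 0 \<longleftrightarrow> T = 0"
    by (transfer; simp add: algebra_simps norm_triangle_ineq)+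
  show "dist S T = norm (S - T)" by (rule dist_cblinfun_def)
  show "sgn T = inverse (norm T) *\<^sub>R T" by (rule sgn_cblinfun_def)
  show "(uniformity :: (('a \<Rightarrow>\<^sub>C\<^sub>L 'b) \<times> ('a \<Rightarrow>\<^sub>C\<^sub>L 'b)) filter)
     = (INF e\<in>{0 <..}. principal {(x, y). dist x y < e})"
    by (rule uniformity_cblinfun_def)
  show "open U = (\<forall>x\<in>U. \<forall>\<^sub>F (x', y) in uniformity. x' = x \<longrightarrow> y \<in> U)"
    by (rule open_cblinfun_def)
  show "c *\<^sub>C (S + T) = c *\<^sub>C S + c *\<^sub>C T" "(c + d) *\<^sub>C T = c *\<^sub>C T + d *\<^sub>C T"
    "c *\<^sub>C d *\<^sub>C T = (c * d) *\<^sub>C T" "complex_of_real r *\<^sub>C T = r *\<^sub>R T"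
    by (rule cblinfun_eqI;
        simp add: cblinfun_apply_plus cblinfun_apply_scaleR cblinfun_apply_scaleC_left
          scaleC_add_right scaleC_add_left scaleC_scaleC scaleC_of_real)+
  have le: "norm (a *\<^sub>C V) \<le> cmod a * norm V" for a and V :: "'a \<Rightarrow>\<^sub>C\<^sub>L 'b"
    by transfer
      (auto simp: Blinfun_scaleC_apply norm_scaleC mult.assoc
        intro!: norm_blinfun_bound mult_left_mono norm_blinfun)
  show "norm (c *\<^sub>C T) = cmod c * norm T"
  proof (cases "c = 0")
    case True
    moreover have "0 \<le> norm (c *\<^sub>C T)"
      by transfer simp
    ultimately show ?thesis using le[of c T] by simp
  next
    case False
    have one: "1 *\<^sub>C T = T"
      by (rule cblinfun_eqI) (simp add: cblinfun_apply_scaleC_left scaleC_one)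
    have "inverse c *\<^sub>C c *\<^sub>C T = T"
      using \<open>c *\<^sub>C d *\<^sub>C T = (c * d) *\<^sub>C T\<close> False one
      by (intro cblinfun_eqI) (simp add: cblinfun_apply_scaleC_left scaleC_scaleC scaleC_one)
    then have "norm T \<le> inverse (cmod c) * norm (c *\<^sub>C T)"
      using le[of "inverse c" "c *\<^sub>C T"] by (simp add: norm_inverse)
    then have "cmod c * norm T \<le> norm (c *\<^sub>C T)"
      using False by (simp add: field_simps)
    then show ?thesis using le[of c T] by linarith
  qed
qed

end

lemma norm_cblinfun_eq_onorm: "norm T = onorm (cblinfun_apply T)"
  by transfer (simp add: norm_blinfun.rep_eq)

instance cblinfun :: (complex_normed_vector, complex_banach) complex_banach
proof
  fix X :: "nat \<Rightarrow> 'a \<Rightarrow>\<^sub>C\<^sub>L 'b"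
  assume "Cauchy X"
  let ?Y = "\<lambda>n. blinfun_of_cblinfun (X n)"
  have dist_eq: "dist (blinfun_of_cblinfun S) (blinfun_of_cblinfun T) = dist S T"
    for S T :: "'a \<Rightarrow>\<^sub>C\<^sub>L 'b"
    by (simp add: dist_norm norm_cblinfun.rep_eq minus_cblinfun.rep_eq)
  have "Cauchy ?Y"
    using \<open>Cauchy X\<close> by (simp add: Cauchy_def dist_eq)
  then obtain L where L: "?Y \<longlonglongrightarrow> L"
    by (meson Cauchy_convergent convergent_def)
  have "blinfun_apply L (c *\<^sub>C x) = c *\<^sub>C blinfun_apply L x" for c x
  proof (rule LIMSEQ_unique)
    have app: "(\<lambda>n. blinfun_apply (?Y n) y) \<longlonglongrightarrow> blinfun_apply L y" for y
      by (intro blinfun.tendsto L tendsto_const)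
    show "(\<lambda>n. blinfun_apply (?Y n) (c *\<^sub>C x)) \<longlonglongrightarrow> blinfun_apply L (c *\<^sub>C x)"
      by (rule app)
    have "(\<lambda>n. c *\<^sub>C blinfun_apply (?Y n) x) \<longlonglongrightarrow> c *\<^sub>C blinfun_apply L x"
      by (rule bounded_linear.tendsto[OF bounded_linear_scaleC app])
    then show "(\<lambda>n. blinfun_apply (?Y n) (c *\<^sub>C x)) \<longlonglongrightarrow> c *\<^sub>C blinfun_apply L x"
      by (simp add: cblinfun_apply.rep_eq[symmetric] cblinfun_apply_scaleC)
  qed
  then have "blinfun_of_cblinfun (cblinfun_of_blinfun L) = L"
    by (simp add: cblinfun_of_blinfun_inverse)
  then have "X \<longlonglongrightarrow> cblinfun_of_blinfun L"
    using L by (simp add: tendsto_iff dist_eq[symmetric])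
  then show "convergent X"
    by (rule convergentI)
qed

definition invertible_blinfun :: "('e::real_normed_vector \<Rightarrow>\<^sub>L 'e) \<Rightarrow> bool"
  where "invertible_blinfun B \<longleftrightarrow> (\<exists>C. B o\<^sub>L C = id_blinfun \<and> C o\<^sub>L B = id_blinfun)"

definition inv_blinfun :: "('e::real_normed_vector \<Rightarrow>\<^sub>L 'e) \<Rightarrow> ('e \<Rightarrow>\<^sub>L 'e)"
  where "inv_blinfun B = (THE C. B o\<^sub>L C = id_blinfun \<and> C o\<^sub>L B = id_blinfun)"

lemma inv_blinfun_eqI:
  assumes "B o\<^sub>L C = id_blinfun" "C o\<^sub>L B = id_blinfun"
  shows "inv_blinfun B = C"
  unfolding inv_blinfun_def
proof (rule the_equality)
  fix D assume D: "B o\<^sub>L D = id_blinfun \<and> D o\<^sub>L B = id_blinfun"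
  show "D = C"
  proof (rule blinfun_eqI)
    fix x
    have "blinfun_apply D x = blinfun_apply (D o\<^sub>L B) (blinfun_apply C x)"
      using assms(1) by (metis blinfun_apply_blinfun_compose blinfun_apply_id_blinfun)
    then show "blinfun_apply D x = blinfun_apply C x"
      using D by simp
  qed
qed (use assms in simp)

definition invertible_cblinfun :: "('e::complex_normed_vector \<Rightarrow>\<^sub>C\<^sub>L 'e) \<Rightarrow> bool"
  where "invertible_cblinfun B \<longleftrightarrow> (\<exists>C. B o\<^sub>C\<^sub>L C = id_cblinfun \<and> C o\<^sub>C\<^sub>L B = id_cblinfun)"

definition inv_cblinfun :: "('e::complex_normed_vector \<Rightarrow>\<^sub>C\<^sub>L 'e) \<Rightarrow> ('e \<Rightarrow>\<^sub>C\<^sub>L 'e)"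
  where "inv_cblinfun B = (THE C. B o\<^sub>C\<^sub>L C = id_cblinfun \<and> C o\<^sub>C\<^sub>L B = id_cblinfun)"

lemma inv_cblinfun_eqI:
  assumes "B o\<^sub>C\<^sub>L C = id_cblinfun" "C o\<^sub>C\<^sub>L B = id_cblinfun"
  shows "inv_cblinfun B = C"
  unfolding inv_cblinfun_def
proof (rule the_equality)
  fix D assume D: "B o\<^sub>C\<^sub>L D = id_cblinfun \<and> D o\<^sub>C\<^sub>L B = id_cblinfun"
  have assoc: "(D o\<^sub>C\<^sub>L B) o\<^sub>C\<^sub>L C = D o\<^sub>C\<^sub>L (B o\<^sub>C\<^sub>L C)"
    by (transfer, rule blinfun_eqI) simp
  have unit: "id_cblinfun o\<^sub>C\<^sub>L C = C" "D o\<^sub>C\<^sub>L id_cblinfun = D"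
    by (transfer, rule blinfun_eqI, simp)+
  show "D = C"
    using assoc unit D assms by simp
qed (use assms in simp)

text \<open>
  A function on \<open>W\<close> is represented by a total function of which only the values on \<open>W\<close>
  are used; likewise for \<open>\<Phi>\<close>, whose continuity is taken within \<open>W\<close>.
\<close>

definition caratheodory_slope ::
  "('x::banach \<Rightarrow> 'y::banach) \<Rightarrow> 'x set \<Rightarrow> 'x \<Rightarrow> ('x \<Rightarrow> ('x \<Rightarrow>\<^sub>L 'y)) \<Rightarrow> bool"
  where "caratheodory_slope f W x \<Phi> \<longleftrightarrow>
    continuous (at x within W) \<Phi> \<and>
    (\<forall>y\<in>W. f y = f x + blinfun_apply (\<Phi> y) (y - x))"

definition caratheodory_differentiable ::
  "('x::banach \<Rightarrow> 'y::banach) \<Rightarrow> 'x set \<Rightarrow> 'x \<Rightarrow> bool"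
  where "caratheodory_differentiable f W x \<longleftrightarrow>
    open W \<and> x \<in> W \<and> (\<exists>\<Phi>. caratheodory_slope f W x \<Phi>)"

definition caratheodory_deriv ::
  "('x::banach \<Rightarrow> 'y::banach) \<Rightarrow> 'x set \<Rightarrow> 'x \<Rightarrow> ('x \<Rightarrow>\<^sub>L 'y)"
  where "caratheodory_deriv f W x = (THE D. \<exists>\<Phi>. caratheodory_slope f W x \<Phi> \<and> D = \<Phi> x)"

text \<open>The same over the complex numbers: the values of \<open>\<Phi>\<close> have to be complex-linear.\<close>

definition complex_caratheodory_slope ::
  "('x::complex_banach \<Rightarrow> 'y::complex_banach) \<Rightarrow> 'x set \<Rightarrow> 'x \<Rightarrow> ('x \<Rightarrow> ('x \<Rightarrow>\<^sub>C\<^sub>L 'y)) \<Rightarrow> bool"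
  where "complex_caratheodory_slope f W x \<Phi> \<longleftrightarrow>
    continuous (at x within W) \<Phi> \<and>
    (\<forall>y\<in>W. f y = f x + cblinfun_apply (\<Phi> y) (y - x))"

definition complex_caratheodory_differentiable ::
  "('x::complex_banach \<Rightarrow> 'y::complex_banach) \<Rightarrow> 'x set \<Rightarrow> 'x \<Rightarrow> bool"
  where "complex_caratheodory_differentiable f W x \<longleftrightarrow>
    open W \<and> x \<in> W \<and> (\<exists>\<Phi>. complex_caratheodory_slope f W x \<Phi>)"

definition complex_caratheodory_deriv ::
  "('x::complex_banach \<Rightarrow> 'y::complex_banach) \<Rightarrow> 'x set \<Rightarrow> 'x \<Rightarrow> ('x \<Rightarrow>\<^sub>C\<^sub>L 'y)"
  where "complex_caratheodory_deriv f W x =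
    (THE D. \<exists>\<Phi>. complex_caratheodory_slope f W x \<Phi> \<and> D = \<Phi> x)"

text \<open>The derivative does not depend on the choice of \<open>\<Phi>\<close>.\<close>

lemma caratheodory_slope_unique:
  fixes f :: "'x::banach \<Rightarrow> 'y::banach"
  assumes W: "open W" "x \<in> W"
    and \<Phi>: "caratheodory_slope f W x \<Phi>" and \<Psi>: "caratheodory_slope f W x \<Psi>"
  shows "\<Phi> x = \<Psi> x"
proof (rule blinfun_eqI)
  fix h :: 'x
  define p where "p n = x + inverse (real (Suc n)) *\<^sub>R h" for n
  have p: "p \<longlonglongrightarrow> x"
    unfolding p_def
    using tendsto_add[OF tendsto_const[of x]
        tendsto_scaleR[OF LIMSEQ_inverse_real_of_nat tendsto_const[of h]]]
    by simp
  have ev: "\<forall>\<^sub>F n in sequentially. blinfun_apply (\<Phi> (p n)) h = blinfun_apply (\<Psi> (p n)) h"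
    using topological_tendstoD[OF p W]
  proof eventually_elim
    case (elim n)
    then have "blinfun_apply (\<Phi> (p n)) (p n - x) = blinfun_apply (\<Psi> (p n)) (p n - x)"
      using \<Phi> \<Psi> unfolding caratheodory_slope_def by (metis add_left_cancel)
    then show ?case
      by (simp add: p_def blinfun.scaleR_right)
  qed
  have lim: "(\<lambda>n. blinfun_apply (\<Theta> (p n)) h) \<longlonglongrightarrow> blinfun_apply (\<Theta> x) h"
    if "caratheodory_slope f W x \<Theta>" for \<Theta>
  proof -
    have "isCont \<Theta> x"
      using that unfolding caratheodory_slope_def at_within_open[OF W(2,1)] by blast
    then have "(\<lambda>n. \<Theta> (p n)) \<longlonglongrightarrow> \<Theta> x"
      using p by (rule isCont_tendsto_compose)
    then show ?thesis
      by (intro blinfun.tendsto tendsto_const)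
  qed
  have "(\<lambda>n. blinfun_apply (\<Psi> (p n)) h) \<longlonglongrightarrow> blinfun_apply (\<Phi> x) h"
    using lim[OF \<Phi>] ev by (rule Lim_transform_eventually)
  then show "blinfun_apply (\<Phi> x) h = blinfun_apply (\<Psi> x) h"
    using lim[OF \<Psi>] by (rule LIMSEQ_unique)
qed

lemma caratheodory_deriv_eqI:
  assumes "open W" "x \<in> W" "caratheodory_slope f W x \<Phi>"
  shows "caratheodory_deriv f W x = \<Phi> x"
  unfolding caratheodory_deriv_def
  using assms caratheodory_slope_unique by blast

lemma caratheodory_slope_of_complex:
  assumes "complex_caratheodory_slope f W x \<Phi>"
  shows "caratheodory_slope f W x (\<lambda>y. blinfun_of_cblinfun (\<Phi> y))"
proof -
  have "dist (blinfun_of_cblinfun S) (blinfun_of_cblinfun T) = dist S T"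
    for S T :: "'a \<Rightarrow>\<^sub>C\<^sub>L 'b"
    by (simp add: dist_norm norm_cblinfun.rep_eq minus_cblinfun.rep_eq)
  then have "continuous (at x within W) (\<lambda>y. blinfun_of_cblinfun (\<Phi> y))
      \<longleftrightarrow> continuous (at x within W) \<Phi>"
    by (simp add: continuous_within tendsto_iff)
  then show ?thesis
    using assms unfolding caratheodory_slope_def complex_caratheodory_slope_def
      cblinfun_apply.rep_eq by blast
qed

lemma complex_caratheodory_deriv_eqI:
  assumes "open W" "x \<in> W" "complex_caratheodory_slope f W x \<Phi>"
  shows "complex_caratheodory_deriv f W x = \<Phi> x"
  unfolding complex_caratheodory_deriv_def
proof (rule the_equality)
  fix D assume "\<exists>\<Psi>. complex_caratheodory_slope f W x \<Psi> \<and> D = \<Psi> x"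
  then obtain \<Psi> where "complex_caratheodory_slope f W x \<Psi>" "D = \<Psi> x" by blast
  then show "D = \<Phi> x"
    using caratheodory_slope_unique[OF assms(1,2) caratheodory_slope_of_complex
        caratheodory_slope_of_complex[OF assms(3)]]
    by (simp add: blinfun_of_cblinfun_inject)
qed (use assms in blast)

end

theory Submission
  imports Defs
begin

text \<open>
  The argument lives in a Banach algebra: it uses only that \<open>\<L>(E)\<close> is complete, with an
  associative, unital and submultiplicative product. The resolvent-type identity
  \<open>B\<inverse> - A\<inverse> = - B\<inverse> (B - A) A\<inverse>\<close> already has the shape that Caratheodory
  differentiability asks for, with slope \<open>\<Phi> B = (Z \<mapsto> - B\<inverse> Z A\<inverse>)\<close>. Since \<open>\<Phi>\<close> depends on
  \<open>B\<close> through \<open>B\<inverse>\<close> in a bounded linear way, its continuity at \<open>A\<close> is the continuity of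
  inversion at \<open>A\<close>, and \<open>\<Phi> A\<close> is the claimed derivative.

  What remains is that the invertible elements form an open set and that inversion is
  continuous. The equation \<open>B C = 1\<close> is equivalent to
  \<open>C = A\<inverse> - A\<inverse> (B - A) C\<close>, whose right-hand side is a contraction in \<open>C\<close> when
  \<open>\<parallel>A\<inverse>\<parallel> \<parallel>B - A\<parallel> < 1\<close>, so Banach's fixed point theorem gives a right inverse, and
  symmetrically a left inverse (lemma \<open>inverse_near\<close>). The same smallness bounds
  \<open>\<parallel>B\<inverse>\<parallel>\<close> near \<open>A\<close>, and then the identity above gives continuity (lemma
  \<open>continuous_inverse\<close>).

  Real and complex operators are two instances of one locale. The algebra is taken over
  the reals in both; over the complex numbers the only additional point is that the values
  of \<open>\<Phi>\<close> are complex-linear.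
\<close>

section \<open>Inversion in a unital Banach algebra\<close>

text \<open>
  The class \<open>real_normed_algebra_1\<close> demands that the unit has norm 1, which fails in
  \<open>\<L>(E)\<close> for \<open>E = 0\<close>; here the norm of the unit is left free.
\<close>

locale unital_banach_algebra = bounded_bilinear mul
  for mul :: "'a::banach \<Rightarrow> 'a \<Rightarrow> 'a"  (infixl \<open>\<odot>\<close> 70) +
  fixes unit :: 'a  (\<open>\<e>\<close>)
  assumes assoc: "(x \<odot> y) \<odot> z = x \<odot> (y \<odot> z)"
    and unit_left: "\<e> \<odot> x = x"
    and unit_right: "x \<odot> \<e> = x"
    and norm_mul_le: "norm (x \<odot> y) \<le> norm x * norm y"
begin

lemma left_inverse_eq_right_inverse:
  assumes "l \<odot> b = \<e>" "b \<odot> r = \<e>"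
  shows "l = r"
  by (metis assms assoc unit_left unit_right)

text \<open>
  Solving \<open>b \<odot> c = \<e>\<close> and \<open>c \<odot> b = \<e>\<close> separately by fixed points avoids powers and the
  Neumann series; associativity makes the two solutions agree.
\<close>

lemma inverse_near:
  assumes a: "a \<odot> a' = \<e>" "a' \<odot> a = \<e>"
    and small: "norm a' * norm (b - a) < 1"
  obtains c where "b \<odot> c = \<e>" "c \<odot> b = \<e>"
proof -
  let ?q = "norm a' * norm (b - a)"
  have "\<exists>!c. a' - a' \<odot> (b - a) \<odot> c = c"
  proof (rule banach_fix_type[where c = ?q])
    show "\<forall>x y. dist (a' - a' \<odot> (b - a) \<odot> x) (a' - a' \<odot> (b - a) \<odot> y) \<le> ?q * dist x y"
    proof (intro allI)
      fix x y
      have "dist (a' - a' \<odot> (b - a) \<odot> x) (a' - a' \<odot> (b - a) \<odot> y)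
          = norm (a' \<odot> (b - a) \<odot> (x - y))"
        by (simp add: dist_norm diff_right norm_minus_commute)
      also have "\<dots> \<le> norm (a' \<odot> (b - a)) * norm (x - y)"
        by (rule norm_mul_le)
      also have "\<dots> \<le> ?q * norm (x - y)"
        by (intro mult_right_mono norm_mul_le norm_ge_zero)
      finally show "dist (a' - a' \<odot> (b - a) \<odot> x) (a' - a' \<odot> (b - a) \<odot> y) \<le> ?q * dist x y"
        by (simp add: dist_norm)
    qed
  qed (use small in auto)
  then obtain r where "a' - a' \<odot> (b - a) \<odot> r = r" by blast
  then have "a \<odot> r = a \<odot> (a' - a' \<odot> (b - a) \<odot> r)" by simp
  also have "\<dots> = \<e> - (b - a) \<odot> r"
    by (simp add: diff_right[of a a'] assoc[symmetric] a unit_left)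
  finally have r: "b \<odot> r = \<e>" by (simp add: diff_left)
  have "\<exists>!c. a' - c \<odot> ((b - a) \<odot> a') = c"
  proof (rule banach_fix_type[where c = ?q])
    show "\<forall>x y. dist (a' - x \<odot> ((b - a) \<odot> a')) (a' - y \<odot> ((b - a) \<odot> a')) \<le> ?q * dist x y"
    proof (intro allI)
      fix x y
      have "dist (a' - x \<odot> ((b - a) \<odot> a')) (a' - y \<odot> ((b - a) \<odot> a'))
          = norm ((x - y) \<odot> ((b - a) \<odot> a'))"
        by (simp add: dist_norm diff_left norm_minus_commute)
      also have "\<dots> \<le> norm (x - y) * norm ((b - a) \<odot> a')"
        by (rule norm_mul_le)
      also have "\<dots> \<le> norm (x - y) * (norm (b - a) * norm a')"
        by (intro mult_left_mono norm_mul_le norm_ge_zero)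
      finally show "dist (a' - x \<odot> ((b - a) \<odot> a')) (a' - y \<odot> ((b - a) \<odot> a')) \<le> ?q * dist x y"
        by (simp add: dist_norm mult_ac)
    qed
  qed (use small in auto)
  then obtain l where "a' - l \<odot> ((b - a) \<odot> a') = l" by blast
  then have "l \<odot> a = (a' - l \<odot> ((b - a) \<odot> a')) \<odot> a" by simp
  also have "\<dots> = \<e> - l \<odot> (b - a)"
    by (simp add: diff_left[of a' _ a] assoc a unit_right)
  finally have l: "l \<odot> b = \<e>" by (simp add: diff_right)
  show thesis
    using that r l left_inverse_eq_right_inverse[OF l r] by blast
qed

lemma open_invertible: "open {b. \<exists>c. b \<odot> c = \<e> \<and> c \<odot> b = \<e>}"
  unfolding open_dist
proof (intro ballI, elim CollectE exE conjE)
  fix a a' assume a: "a \<odot> a' = \<e>" "a' \<odot> a = \<e>"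
  \<comment> \<open>The summand 1 keeps the radius meaningful when \<open>a'\<close> vanishes, as it does in the zero algebra.\<close>
  show "\<exists>d>0. \<forall>b. dist b a < d \<longrightarrow> b \<in> {b. \<exists>c. b \<odot> c = \<e> \<and> c \<odot> b = \<e>}"
  proof (intro exI[of _ "inverse (norm a' + 1)"] conjI allI impI)
    show "0 < inverse (norm a' + 1)"
      by (simp add: add_nonneg_pos)
  next
    fix b assume "dist b a < inverse (norm a' + 1)"
    then have "(norm a' + 1) * norm (b - a) < 1"
      by (simp add: dist_norm pos_less_divide_eq inverse_eq_divide add_nonneg_pos mult.commute)
    then have "norm a' * norm (b - a) < 1"
      using norm_ge_zero[of "b - a"] by (simp add: distrib_right del: norm_ge_zero)
    then show "b \<in> {b. \<exists>c. b \<odot> c = \<e> \<and> c \<odot> b = \<e>}"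
      using inverse_near[OF a] by blast
  qed
qed

lemma inverse_diff:
  assumes "a \<odot> a' = \<e>" "c \<odot> b = \<e>"
  shows "c - a' = - (c \<odot> (b - a) \<odot> a')"
proof -
  have "c \<odot> (b - a) \<odot> a' = c \<odot> b \<odot> a' - c \<odot> (a \<odot> a')"
    by (simp add: diff_left diff_right assoc)
  then show ?thesis
    by (simp add: assms unit_left unit_right)
qed

text \<open>
  By \<open>inverse_diff\<close>, \<open>\<parallel>c\<parallel> \<le> \<parallel>a'\<parallel> + \<parallel>c\<parallel> \<parallel>b - a\<parallel> \<parallel>a'\<parallel>\<close>; once the factor of \<open>\<parallel>c\<parallel>\<close> on the right is
  at most \<open>1/2\<close> it is absorbed on the left, so \<open>\<parallel>c\<parallel> \<le> 2 \<parallel>a'\<parallel>\<close>.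
\<close>

lemma norm_inverse_diff_le:
  assumes a: "a \<odot> a' = \<e>" "a' \<odot> a = \<e>" and b: "c \<odot> b = \<e>"
    and small: "norm a' * norm (b - a) \<le> 1 / 2"
  shows "norm (c - a') \<le> 2 * (norm a')\<^sup>2 * norm (b - a)"
proof -
  have "norm (c - a') \<le> norm (c \<odot> (b - a)) * norm a'"
    using norm_mul_le[of "c \<odot> (b - a)" a'] inverse_diff[OF a(1) b] by simp
  also have "\<dots> \<le> norm c * norm (b - a) * norm a'"
    by (intro mult_right_mono norm_mul_le norm_ge_zero)
  finally have diff: "norm (c - a') \<le> norm c * (norm a' * norm (b - a))"
    by (simp add: mult_ac)
  have "norm c \<le> norm a' + norm (c - a')"
    using norm_triangle_ineq[of a' "c - a'"] by simp
  also have "\<dots> \<le> norm a' + norm c * (1 / 2)"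
    using diff mult_left_mono[OF small norm_ge_zero[of c]] by simp
  finally have "norm c \<le> 2 * norm a'" by simp
  then have "norm c * (norm a' * norm (b - a)) \<le> 2 * norm a' * (norm a' * norm (b - a))"
    by (intro mult_right_mono) auto
  with diff show ?thesis
    by (simp add: power2_eq_square mult_ac)
qed

text \<open>
  The inverse enters as any function \<open>J\<close> that sends invertible elements to their inverses;
  its other values are arbitrary.
\<close>

lemma continuous_inverse:
  assumes J: "\<And>b c. b \<odot> c = \<e> \<Longrightarrow> c \<odot> b = \<e> \<Longrightarrow> J b = c"
    and a: "a \<odot> a' = \<e>" "a' \<odot> a = \<e>"
  shows "isCont J a"
proof -
  have lim: "((\<lambda>b. k * norm (b - a)) \<longlongrightarrow> 0) (at a)" for k
    by (auto intro!: tendsto_eq_intros)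
  have "\<forall>\<^sub>F b in at a. norm (J b - J a) \<le> 2 * (norm a')\<^sup>2 * norm (b - a)"
    using order_tendstoD(2)[OF lim[of "norm a'"], of "1 / 2", simplified]
  proof eventually_elim
    case (elim b)
    then obtain c where c: "b \<odot> c = \<e>" "c \<odot> b = \<e>"
      using inverse_near[OF a, of b] by auto
    show ?case
      using norm_inverse_diff_le[OF a c(2)] elim J[OF c] J[OF a] by simp
  qed
  then have "((\<lambda>b. J b - J a) \<longlongrightarrow> 0) (at a)"
    using lim by (rule Lim_null_comparison)
  then show ?thesis
    using LIM_zero_cancel unfolding isCont_def by blast
qed

definition sandwich :: "'a \<Rightarrow> 'a \<Rightarrow> ('a \<Rightarrow>\<^sub>L 'a)"
  where "sandwich p q = Blinfun (\<lambda>z. p \<odot> z \<odot> q)"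

lemma sandwich_apply: "blinfun_apply (sandwich p q) z = p \<odot> z \<odot> q"
  unfolding sandwich_def
  using bounded_linear_compose[OF bounded_linear_left[of q] bounded_linear_right[of p]]
  by (simp add: bounded_linear_Blinfun_apply)

lemma bounded_linear_sandwich_left: "bounded_linear (\<lambda>p. sandwich p q)"
proof (rule bounded_linear_intro[where K = "norm q"])
  fix p p' :: 'a and r :: real
  show "sandwich (p + p') q = sandwich p q + sandwich p' q"
    by (rule blinfun_eqI) (simp add: sandwich_apply blinfun.add_left add_left)
  show "sandwich (r *\<^sub>R p) q = r *\<^sub>R sandwich p q"
    by (rule blinfun_eqI) (simp add: sandwich_apply blinfun.scaleR_left scaleR_left)
  show "norm (sandwich p q) \<le> norm p * norm q"
  proof (rule norm_blinfun_bound)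
    fix z
    have "norm (p \<odot> z \<odot> q) \<le> norm (p \<odot> z) * norm q"
      by (rule norm_mul_le)
    also have "\<dots> \<le> norm p * norm z * norm q"
      by (intro mult_right_mono norm_mul_le norm_ge_zero)
    finally show "norm (blinfun_apply (sandwich p q) z) \<le> norm p * norm q * norm z"
      by (simp add: sandwich_apply mult_ac)
  qed simp
qed

lemma caratheodory_slope_inverse:
  assumes J: "\<And>b c. b \<odot> c = \<e> \<Longrightarrow> c \<odot> b = \<e> \<Longrightarrow> J b = c"
    and a: "a \<odot> a' = \<e>" "a' \<odot> a = \<e>"
  shows "caratheodory_slope J {b. \<exists>c. b \<odot> c = \<e> \<and> c \<odot> b = \<e>} a (\<lambda>b. - sandwich (J b) (J a))"
  unfolding caratheodory_slope_def
proof (intro conjI ballI)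
  show "continuous (at a within {b. \<exists>c. b \<odot> c = \<e> \<and> c \<odot> b = \<e>}) (\<lambda>b. - sandwich (J b) (J a))"
    by (rule continuous_at_imp_continuous_at_within, rule continuous_minus,
        rule bounded_linear.continuous[OF bounded_linear_sandwich_left continuous_inverse[OF J a]])
next
  fix b assume "b \<in> {b. \<exists>c. b \<odot> c = \<e> \<and> c \<odot> b = \<e>}"
  then obtain c where c: "b \<odot> c = \<e>" "c \<odot> b = \<e>" by blast
  show "J b = J a + blinfun_apply (- sandwich (J b) (J a)) (b - a)"
    unfolding blinfun.minus_left sandwich_apply J[OF c] J[OF a]
      inverse_diff[OF a(1) c(2), symmetric]
    by simp
qed

end

section \<open>Operators on real and complex Banach spaces\<close>

interpretation real_operators: unital_banach_algebra
  "(o\<^sub>L) :: ('e::banach \<Rightarrow>\<^sub>L 'e) \<Rightarrow> _" id_blinfun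
proof (intro unital_banach_algebra.intro unital_banach_algebra_axioms.intro)
  show "bounded_bilinear ((o\<^sub>L) :: ('e \<Rightarrow>\<^sub>L 'e) \<Rightarrow> _)"
    by (rule bounded_bilinear_blinfun_compose)
qed (auto intro: blinfun_eqI norm_blinfun_compose)

lemma norm_cblinfun_compose: "norm (S o\<^sub>C\<^sub>L T) \<le> norm S * norm T"
  by transfer (rule norm_blinfun_compose)

lemma bounded_bilinear_cblinfun_compose: "bounded_bilinear (o\<^sub>C\<^sub>L)"
proof
  show "\<exists>K. \<forall>S T. norm (S o\<^sub>C\<^sub>L T) \<le> norm S * norm T * K"
    by (intro exI[of _ 1] allI) (simp add: norm_cblinfun_compose)
qed (transfer, rule blinfun_eqI, simp add: blinfun.bilinear_simps)+

interpretation complex_operators: unital_banach_algebra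
  "(o\<^sub>C\<^sub>L) :: ('f::complex_banach \<Rightarrow>\<^sub>C\<^sub>L 'f) \<Rightarrow> _" id_cblinfun
proof (intro unital_banach_algebra.intro unital_banach_algebra_axioms.intro)
  show "bounded_bilinear ((o\<^sub>C\<^sub>L) :: ('f \<Rightarrow>\<^sub>C\<^sub>L 'f) \<Rightarrow> _)"
    by (rule bounded_bilinear_cblinfun_compose)
qed (rule norm_cblinfun_compose | transfer, rule blinfun_eqI, simp)+

text \<open>
  The real slope \<open>Z \<mapsto> - B\<inverse> Z A\<inverse>\<close> of complex inversion becomes a complex one once its values
  are known to commute with complex scalars; the embedding of complex-linear into real-linear
  operators is isometric, so continuity carries over.
\<close>

lemma complex_caratheodory_slopeI:
  fixes f :: "'x::complex_banach \<Rightarrow> 'y::complex_banach"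
  assumes slope: "caratheodory_slope f W x \<Phi>"
    and linear: "\<And>b c z. blinfun_apply (\<Phi> b) (c *\<^sub>C z) = c *\<^sub>C blinfun_apply (\<Phi> b) z"
  shows "complex_caratheodory_slope f W x (\<lambda>b. cblinfun_of_blinfun (\<Phi> b))"
proof -
  have embed: "blinfun_of_cblinfun (cblinfun_of_blinfun (\<Phi> b)) = \<Phi> b" for b
    by (rule cblinfun_of_blinfun_inverse) (simp add: linear)
  then have "dist (cblinfun_of_blinfun (\<Phi> b)) (cblinfun_of_blinfun (\<Phi> b')) = dist (\<Phi> b) (\<Phi> b')"
    for b b'
    by (simp add: dist_norm norm_cblinfun.rep_eq minus_cblinfun.rep_eq)
  then show ?thesis
    using slope
    by (simp add: caratheodory_slope_def complex_caratheodory_slope_def continuous_within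
        tendsto_iff cblinfun_apply.rep_eq embed)
qed

lemma cblinfun_apply_compose: "cblinfun_apply (S o\<^sub>C\<^sub>L T) x = cblinfun_apply S (cblinfun_apply T x)"
  by (simp add: cblinfun_apply.rep_eq cblinfun_compose.rep_eq)

lemma cblinfun_compose_scaleC_left: "(c *\<^sub>C S) o\<^sub>C\<^sub>L T = c *\<^sub>C (S o\<^sub>C\<^sub>L T)"
  by (rule cblinfun_eqI) (simp add: cblinfun_apply_scaleC_left cblinfun_apply_compose)

lemma cblinfun_compose_scaleC_right: "S o\<^sub>C\<^sub>L (c *\<^sub>C T) = c *\<^sub>C (S o\<^sub>C\<^sub>L T)"
  by (rule cblinfun_eqI)
    (simp add: cblinfun_apply_scaleC_left cblinfun_apply_compose cblinfun_apply_scaleC)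

theorem theorem3p4:
  fixes A :: "'e::banach \<Rightarrow>\<^sub>L 'e"
    and A' :: "'f::complex_banach \<Rightarrow>\<^sub>C\<^sub>L 'f"
  shows
    "(invertible_blinfun A \<longrightarrow>
        caratheodory_differentiable inv_blinfun {B. invertible_blinfun B} A \<and>
        (\<forall>Z. blinfun_apply (caratheodory_deriv inv_blinfun {B. invertible_blinfun B} A) Z
              = - (inv_blinfun A o\<^sub>L Z o\<^sub>L inv_blinfun A))) \<and>
     (invertible_cblinfun A' \<longrightarrow>
        complex_caratheodory_differentiable inv_cblinfun {B. invertible_cblinfun B} A' \<and>
        (\<forall>Z. cblinfun_apply (complex_caratheodory_deriv inv_cblinfun {B. invertible_cblinfun B} A') Z
              = - (inv_cblinfun A' o\<^sub>C\<^sub>L Z o\<^sub>C\<^sub>L inv_cblinfun A')))"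
proof (intro conjI impI)
  let ?W = "{B :: 'e \<Rightarrow>\<^sub>L 'e. invertible_blinfun B}"
  assume "invertible_blinfun A"
  then obtain C where C: "A o\<^sub>L C = id_blinfun" "C o\<^sub>L A = id_blinfun" and W: "A \<in> ?W"
    unfolding invertible_blinfun_def by blast
  let ?\<Phi> = "\<lambda>B. - real_operators.sandwich (inv_blinfun B) (inv_blinfun A)"
  have op: "open ?W"
    unfolding invertible_blinfun_def by (rule real_operators.open_invertible)
  have slope: "caratheodory_slope inv_blinfun ?W A ?\<Phi>"
    unfolding invertible_blinfun_def
    by (rule real_operators.caratheodory_slope_inverse[OF inv_blinfun_eqI C])
  show "caratheodory_differentiable inv_blinfun ?W A"
    unfolding caratheodory_differentiable_def using op W slope by blast
  show "\<forall>Z. blinfun_apply (caratheodory_deriv inv_blinfun ?W A) Z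
      = - (inv_blinfun A o\<^sub>L Z o\<^sub>L inv_blinfun A)"
    by (simp add: caratheodory_deriv_eqI[OF op W slope] blinfun.minus_left
        real_operators.sandwich_apply)
next
  let ?W = "{B :: 'f \<Rightarrow>\<^sub>C\<^sub>L 'f. invertible_cblinfun B}"
  assume "invertible_cblinfun A'"
  then obtain C where C: "A' o\<^sub>C\<^sub>L C = id_cblinfun" "C o\<^sub>C\<^sub>L A' = id_cblinfun" and W: "A' \<in> ?W"
    unfolding invertible_cblinfun_def by blast
  let ?\<Phi> = "\<lambda>B. - complex_operators.sandwich (inv_cblinfun B) (inv_cblinfun A')"
  have op: "open ?W"
    unfolding invertible_cblinfun_def by (rule complex_operators.open_invertible)
  have linear: "blinfun_apply (?\<Phi> B) (c *\<^sub>C Z) = c *\<^sub>C blinfun_apply (?\<Phi> B) Z" for B c Z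
    by (simp add: blinfun.minus_left complex_operators.sandwich_apply scaleC_minus_right
        cblinfun_compose_scaleC_left cblinfun_compose_scaleC_right)
  have "caratheodory_slope inv_cblinfun ?W A' ?\<Phi>"
    unfolding invertible_cblinfun_def
    by (rule complex_operators.caratheodory_slope_inverse[OF inv_cblinfun_eqI C])
  then have slope: "complex_caratheodory_slope inv_cblinfun ?W A'
      (\<lambda>B. cblinfun_of_blinfun (?\<Phi> B))"
    using linear by (rule complex_caratheodory_slopeI)
  show "complex_caratheodory_differentiable inv_cblinfun ?W A'"
    unfolding complex_caratheodory_differentiable_def using op W slope by blast
  have "blinfun_of_cblinfun (cblinfun_of_blinfun (?\<Phi> A')) = ?\<Phi> A'"
    by (rule cblinfun_of_blinfun_inverse) (use linear in blast)
  then show "\<forall>Z. cblinfun_apply (complex_caratheodory_deriv inv_cblinfun ?W A') Z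
      = - (inv_cblinfun A' o\<^sub>C\<^sub>L Z o\<^sub>C\<^sub>L inv_cblinfun A')"
    by (simp add: complex_caratheodory_deriv_eqI[OF op W slope] cblinfun_apply.rep_eq
        blinfun.minus_left complex_operators.sandwich_apply)
qed

end
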